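(* Let $f_1,\dots,f_m:\mathbb{R}^n\to\mathbb{R}$ be continuously differentiable, and let $\{x_k\}$ and $\{B_k\}$ be generated by the algorithm MFQNMO described in the context, started from $x_0\in\mathbb{R}^n$ and a symmetric positive definite matrix $B_0$. If the iterates $x_k$ are not Pareto critical, then $B_k$ is positive definite for all $k\ge 0$.
   Context: Setting: the unconstrained multiobjective problem $\min_{x\in\mathbb{R}^n} f(x)=(f_1(x),\dots,f_m(x))^\top$; $[m]=\{1,\dots,m\}$; $\Delta_m=\{\lambda\in\mathbb{R}^m:\lambda_i\ge 0,\ \sum_{i}\lambda_i=1\}$; $\|\cdot\|$ is the Euclidean norm and, for symmetric positive definite $B$, $\|x\|_B=\sqrt{x^\top Bx}$. No convexity of the $f_i$ is assumed. A point $x$ is Pareto critical if for every $d\in\mathbb{R}^n$ there exists $i\in[m]$ with $\nabla f_i(x)^\top d\ge 0$. Put $\mathcal{D}(x,d)=\max_{i\in[m]}\nabla f_i(x)^\top d$. Algorithm MFQNMO. Fix $0<\sigma_1<\sigma_2<1$, $x_0\in\mathbb{R}^n$ and $B_0\succ 0$ symmetric. At iteration $k\ge 0$, given $x_k$ and $B_k$: (1) let $\lambda^k=(\lambda^k_1,\dots,\lambda^k_m)\in\Delta_m$ be a minimizer over $\lambda\in\Delta_m$ of $\frac12\big\|\sum_{i}\lambda_i\nabla f_i(x_k)\big\|^2_{B_k^{-1}}$, and set $d_k=-B_k^{-1}\sum_{i}\lambda^k_i\nabla f_i(x_k)$ (equivalently, $d_k$ is the unique minimizer over $d\in\mathbb{R}^n$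 of $\max_{i\in[m]}\nabla f_i(x_k)^\top d+\frac12 d^\top B_kd$); (2) choose a step size $\alpha_k>0$ satisfying the Wolfe conditions $f_i(x_k+\alpha_kd_k)\le f_i(x_k)+\sigma_1\alpha_k\mathcal{D}(x_k,d_k)$ for all $i\in[m]$, and $\mathcal{D}(x_k+\alpha_kd_k,d_k)\ge\sigma_2\mathcal{D}(x_k,d_k)$; (3) set $x_{k+1}=x_k+\alpha_kd_k$, $s_k=x_{k+1}-x_k$, $y_k=\sum_{i}\lambda^k_i(\nabla f_i(x_{k+1})-\nabla f_i(x_k))$; (4) set $\eta_k=\dfrac{y_k^\top s_k}{\|s_k\|^2}$, $m_k=\max\{-\eta_k,0\}+\sum_{i}\lambda^k_i\,(f_i(x_k)-f_i(x_{k+1}))$, $\gamma_k=y_k+m_ks_k$; (5) update $B_{k+1}=B_k-\dfrac{B_ks_ks_k^\top B_k}{s_k^\top B_ks_k}+\dfrac{\gamma_k\gamma_k^\top}{\gamma_k^\top s_k}$. The stopping test is disregarded, so iterations are carried out as long as the iterates are not Pareto critical. *)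

theory Defs
  imports "HOL-Analysis.Analysis"
begin

text \<open>
  The objectives are a family \<open>f\<close> indexed by a finite type \<open>'m\<close> (in the role of the index set
  \<open>{1..m}\<close>), on the space \<^typ>\<open>real ^ 'n\<close>.
\<close>

definition grad :: "(real ^ 'n \<Rightarrow> real) \<Rightarrow> real ^ 'n \<Rightarrow> real ^ 'n" where
  "grad h x = (THE g. GDERIV h x :> g)"

definition cont_diff :: "(real ^ 'n \<Rightarrow> real) \<Rightarrow> bool" where
  "cont_diff h \<longleftrightarrow> (\<forall>x. h differentiable (at x)) \<and> continuous_on UNIV (grad h)"

text \<open>Positive definiteness of a matrix is understood to include symmetry.\<close>

definition pos_def :: "real ^ 'n ^ 'n \<Rightarrow> bool" where
  "pos_def B \<longleftrightarrow> transpose B = B \<and> (\<forall>v. v \<noteq> 0 \<longrightarrow> v \<bullet> (B *v v) > 0)"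

definition mat_norm :: "real ^ 'n ^ 'n \<Rightarrow> real ^ 'n \<Rightarrow> real" where
  "mat_norm B v = sqrt (v \<bullet> (B *v v))"

definition outer :: "real ^ 'n \<Rightarrow> real ^ 'n \<Rightarrow> real ^ 'n ^ 'n" where
  "outer u v = (\<chi> i j. u $ i * v $ j)"

definition unit_simplex :: "(real ^ 'm) set" where
  "unit_simplex = {l. (\<forall>i. 0 \<le> l $ i) \<and> (\<Sum>i\<in>UNIV. l $ i) = 1}"

definition pareto_critical :: "('m::finite \<Rightarrow> real ^ 'n \<Rightarrow> real) \<Rightarrow> real ^ 'n \<Rightarrow> bool" where
  "pareto_critical f x \<longleftrightarrow> (\<forall>d. \<exists>i. grad (f i) x \<bullet> d \<ge> 0)"

definition max_dir :: "('m::finite \<Rightarrow> real ^ 'n \<Rightarrow> real) \<Rightarrow> real ^ 'n \<Rightarrow> real ^ 'n \<Rightarrow> real" where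
  "max_dir f x d = (MAX i. grad (f i) x \<bullet> d)"

definition comb_grad ::
    "('m::finite \<Rightarrow> real ^ 'n \<Rightarrow> real) \<Rightarrow> real ^ 'm \<Rightarrow> real ^ 'n \<Rightarrow> real ^ 'n" where
  "comb_grad f l x = (\<Sum>i\<in>UNIV. l $ i *\<^sub>R grad (f i) x)"

definition wolfe ::
    "('m::finite \<Rightarrow> real ^ 'n \<Rightarrow> real) \<Rightarrow> real \<Rightarrow> real \<Rightarrow> real ^ 'n \<Rightarrow> real ^ 'n \<Rightarrow> real \<Rightarrow> bool" where
  "wolfe f \<sigma>1 \<sigma>2 x d \<alpha> \<longleftrightarrow>
     (\<forall>i. f i (x + \<alpha> *\<^sub>R d) \<le> f i x + \<sigma>1 * \<alpha> * max_dir f x d) \<and>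
     max_dir f (x + \<alpha> *\<^sub>R d) d \<ge> \<sigma>2 * max_dir f x d"

text \<open>The quasi-Newton update, with \<open>x\<close>, \<open>x'\<close> the current and the next iterate and
  \<open>l\<close> the multiplier vector at \<open>x\<close>.\<close>

definition mfqnmo_update ::
    "('m::finite \<Rightarrow> real ^ 'n \<Rightarrow> real) \<Rightarrow> real ^ 'n \<Rightarrow> real ^ 'n \<Rightarrow> real ^ 'm
      \<Rightarrow> real ^ 'n ^ 'n \<Rightarrow> real ^ 'n ^ 'n" where
  "mfqnmo_update f x x' l B =
     (let s = x' - x;
          y = (\<Sum>i\<in>UNIV. l $ i *\<^sub>R (grad (f i) x' - grad (f i) x));
          \<eta> = (y \<bullet> s) / (norm s)\<^sup>2;
          m = max (- \<eta>) 0 + (\<Sum>i\<in>UNIV. l $ i * (f i x - f i x'));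
          \<gamma> = y + m *\<^sub>R s
      in B - (1 / (s \<bullet> (B *v s))) *\<^sub>R (B ** outer s s ** B)
           + (1 / (\<gamma> \<bullet> s)) *\<^sub>R outer \<gamma> \<gamma>)"

text \<open>One iteration is a relation, since neither the multiplier vector \<open>l\<close> nor the step size
  \<open>\<alpha>\<close> is determined uniquely by \<open>x\<close> and \<open>B\<close>.\<close>

definition mfqnmo_step ::
    "('m::finite \<Rightarrow> real ^ 'n \<Rightarrow> real) \<Rightarrow> real \<Rightarrow> real \<Rightarrow> real ^ 'n \<Rightarrow> real ^ 'n ^ 'n
      \<Rightarrow> real ^ 'n \<Rightarrow> real ^ 'n ^ 'n \<Rightarrow> bool" where
  "mfqnmo_step f \<sigma>1 \<sigma>2 x B x' B' \<longleftrightarrow>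
     (\<exists>l d \<alpha>.
        is_arg_min (\<lambda>\<mu>. 1/2 * (mat_norm (matrix_inv B) (comb_grad f \<mu> x))\<^sup>2)
                   (\<lambda>\<mu>. \<mu> \<in> unit_simplex) l \<and>
        d = - (matrix_inv B *v comb_grad f l x) \<and>
        \<alpha> > 0 \<and> wolfe f \<sigma>1 \<sigma>2 x d \<alpha> \<and>
        x' = x + \<alpha> *\<^sub>R d \<and>
        B' = mfqnmo_update f x x' l B)"

definition mfqnmo_sequence ::
    "('m::finite \<Rightarrow> real ^ 'n \<Rightarrow> real) \<Rightarrow> real \<Rightarrow> real \<Rightarrow> real ^ 'n \<Rightarrow> real ^ 'n ^ 'n
      \<Rightarrow> (nat \<Rightarrow> real ^ 'n) \<Rightarrow> (nat \<Rightarrow> real ^ 'n ^ 'n) \<Rightarrow> bool" where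
  "mfqnmo_sequence f \<sigma>1 \<sigma>2 x0 B0 x B \<longleftrightarrow>
     x 0 = x0 \<and> B 0 = B0 \<and> (\<forall>k. mfqnmo_step f \<sigma>1 \<sigma>2 (x k) (B k) (x (Suc k)) (B (Suc k)))"

end

theory Submission
  imports Defs
begin

text \<open>
  The proof is an induction on the iteration, and each step rests on two facts.

  The first is that the update is of BFGS type, in the pair \<open>(s, \<gamma>)\<close>, and such an update of a
  positive definite \<open>B\<close> is positive definite as soon as the curvature condition
  \<open>\<gamma> \<bullet> s > 0\<close> holds (\<open>pos_def_bfgs_update\<close>): subtracting the first rank-one term leaves
  the form of \<open>B\<close> evaluated at the component \<open>B\<close>-orthogonal to \<open>s\<close>, which vanishes only on the
  line of \<open>s\<close>, and there the second rank-one term is positive.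

  The second is that the shift \<open>m\<close> in \<open>\<gamma> = y + m s\<close> forces the curvature condition
  whatever the sign of \<open>y \<bullet> s\<close> (\<open>shifted_curvature_pos\<close>).  Indeed \<open>(\<gamma> \<bullet> s) / \<parallel>s\<parallel>\<^sup>2 = max \<eta> 0 + \<delta>\<close>, where
  \<open>\<eta> = (y \<bullet> s) / \<parallel>s\<parallel>\<^sup>2\<close> and \<open>\<delta>\<close> is the decrease of the scalarized objective.  This
  decrease is strictly positive: by the first-order optimality of the multipliers
  (\<open>minimizer_variational_inequality\<close>) the direction \<open>d\<close> makes a strictly negative inner
  product with every gradient when \<open>x\<close> is not Pareto critical
  (\<open>max_dir_neg_if_not_critical\<close>), and then the sufficient decrease condition lowers every
  objective.
\<close>

section \<open>Positive definite matrices and the BFGS update\<close>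

lemma pos_def_inner_commute:
  assumes "pos_def B"
  shows "u \<bullet> (B *v v) = v \<bullet> (B *v u)"
proof -
  have "u \<bullet> (B *v v) = (transpose B *v u) \<bullet> v"
    by (simp add: dot_lmul_matrix transpose_matrix_vector)
  also have "\<dots> = v \<bullet> (B *v u)"
    using assms by (simp add: pos_def_def inner_commute)
  finally show ?thesis .
qed

lemma pos_defI:
  fixes B :: "real ^ 'n ^ 'n"
  assumes sym: "\<And>u v. u \<bullet> (B *v v) = v \<bullet> (B *v u)"
    and pos: "\<And>v. v \<noteq> 0 \<Longrightarrow> v \<bullet> (B *v v) > 0"
  shows "pos_def B"
proof -
  have "transpose B *v u = B *v u" for u
  proof (rule vector_eq_rdot[THEN iffD1], rule allI)
    fix v
    show "(transpose B *v u) \<bullet> v = (B *v u) \<bullet> v"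
      using sym[of u v]
      by (simp add: dot_lmul_matrix transpose_matrix_vector inner_commute[of "B *v u"])
  qed
  then have "transpose B = B"
    by (simp add: matrix_eq)
  with pos show ?thesis
    by (simp add: pos_def_def)
qed

lemma pos_def_matrix_inv_right:
  fixes B :: "real ^ 'n ^ 'n"
  assumes "pos_def B"
  shows "B *v (matrix_inv B *v v) = v"
proof -
  have "\<forall>v. B *v v = 0 \<longrightarrow> v = 0"
    using assms by (force simp: pos_def_def)
  then have "invertible B"
    by (simp add: invertible_left_inverse matrix_left_invertible_ker)
  then have "B ** matrix_inv B = mat 1"
    unfolding matrix_inv_def invertible_def by (rule someI2_ex) simp
  then show ?thesis
    by (simp add: matrix_vector_mul_assoc)
qed

lemma pos_def_matrix_inv:
  fixes B :: "real ^ 'n ^ 'n"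
  assumes "pos_def B"
  shows "pos_def (matrix_inv B)"
proof (rule pos_defI)
  note inv = pos_def_matrix_inv_right[OF assms]
  show "u \<bullet> (matrix_inv B *v v) = v \<bullet> (matrix_inv B *v u)" for u v
    using pos_def_inner_commute[OF assms, of "matrix_inv B *v v" "matrix_inv B *v u"]
    by (simp add: inv inner_commute)
  show "v \<bullet> (matrix_inv B *v v) > 0" if "v \<noteq> 0" for v
  proof -
    have "matrix_inv B *v v \<noteq> 0"
      using inv[of v] that by auto
    then have "(matrix_inv B *v v) \<bullet> (B *v (matrix_inv B *v v)) > 0"
      using assms by (simp add: pos_def_def)
    then show ?thesis
      by (simp add: inv inner_commute)
  qed
qed

lemma outer_mult_vector: "outer u v *v w = (v \<bullet> w) *\<^sub>R u"
  by (simp add: vec_eq_iff outer_def matrix_vector_mult_def inner_vec_def sum_distrib_left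
      sum_distrib_right mult_ac)

text \<open>
  With \<open>t = (s \<bullet> B v) / (s \<bullet> B s)\<close> and \<open>w = v - t s\<close>, the first two terms of the updated
  quadratic form at \<open>v\<close> are exactly \<open>w \<bullet> B w\<close>.  If \<open>w \<noteq> 0\<close> this is positive; if
  \<open>w = 0\<close>, then \<open>v\<close> is a nonzero multiple of \<open>s\<close> and the last term equals
  \<open>t\<^sup>2 (\<gamma> \<bullet> s)\<close>.
\<close>

lemma pos_def_bfgs_update:
  fixes B :: "real ^ 'n ^ 'n"
  assumes B: "pos_def B" and curv: "\<gamma> \<bullet> s > 0"
  shows "pos_def (B - (1 / (s \<bullet> (B *v s))) *\<^sub>R (B ** outer s s ** B)
                    + (1 / (\<gamma> \<bullet> s)) *\<^sub>R outer \<gamma> \<gamma>)" (is "pos_def ?B'")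
proof -
  define b where "b = s \<bullet> (B *v s)"
  note sym = pos_def_inner_commute[OF B]
  have "s \<noteq> 0"
    using curv by auto
  then have b: "b > 0"
    using B by (simp add: b_def pos_def_def)
  have form: "u \<bullet> (?B' *v v) = u \<bullet> (B *v v) - (s \<bullet> (B *v u)) * (s \<bullet> (B *v v)) / b
      + (\<gamma> \<bullet> u) * (\<gamma> \<bullet> v) / (\<gamma> \<bullet> s)" for u v
  proof -
    have "?B' *v v = B *v v - (s \<bullet> (B *v v) / b) *\<^sub>R (B *v s) + (\<gamma> \<bullet> v / (\<gamma> \<bullet> s)) *\<^sub>R \<gamma>"
      by (simp add: b_def matrix_vector_mult_add_rdistrib matrix_vector_mult_diff_rdistrib
          scaleR_matrix_vector_assoc[symmetric] matrix_vector_mul_assoc[symmetric]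
          outer_mult_vector matrix_vector_mult_scaleR)
    then show ?thesis
      using sym[of u s] by (simp add: inner_add_right inner_diff_right inner_commute mult.commute)
  qed
  show ?thesis
  proof (rule pos_defI)
    show "u \<bullet> (?B' *v v) = v \<bullet> (?B' *v u)" for u v
      unfolding form using sym[of u v] by (simp add: mult.commute)
    show "v \<bullet> (?B' *v v) > 0" if "v \<noteq> 0" for v
    proof -
      define t where "t = (s \<bullet> (B *v v)) / b"
      define w where "w = v - t *\<^sub>R s"
      have tb: "s \<bullet> (B *v v) = t * b"
        using b by (simp add: t_def)
      have "w \<bullet> (B *v w) = v \<bullet> (B *v v) - 2 * t * (s \<bullet> (B *v v)) + t * t * b"
        using sym[of v s]
        by (simp add: w_def b_def matrix_vector_mult_diff_distrib matrix_vector_mult_scaleR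
            inner_diff_left inner_diff_right algebra_simps)
      then have split: "v \<bullet> (?B' *v v) = w \<bullet> (B *v w) + (\<gamma> \<bullet> v)\<^sup>2 / (\<gamma> \<bullet> s)"
        using b unfolding form tb by (simp add: power2_eq_square)
      show ?thesis
      proof (cases "w = 0")
        case True
        then have v: "v = t *\<^sub>R s"
          by (simp add: w_def)
        with \<open>v \<noteq> 0\<close> have "t \<noteq> 0"
          by auto
        then have "(\<gamma> \<bullet> v)\<^sup>2 / (\<gamma> \<bullet> s) > 0"
          using curv by (simp add: v)
        with split True show ?thesis
          by simp
      next
        case False
        then have "w \<bullet> (B *v w) > 0"
          using B by (simp add: pos_def_def)
        moreover have "(\<gamma> \<bullet> v)\<^sup>2 / (\<gamma> \<bullet> s) \<ge> 0"
          using curv by simp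
        ultimately show ?thesis
          using split by linarith
      qed
    qed
  qed
qed

section \<open>The search direction is a descent direction for every objective\<close>

text \<open>
  First-order optimality along a segment: the one-sided derivative at \<open>t = 0\<close> of
  \<open>t \<mapsto> (g + t p) \<bullet> H (g + t p)\<close> is \<open>2 (p \<bullet> H g)\<close>, and it cannot be negative at a
  minimizer.
\<close>

lemma minimizer_variational_inequality:
  fixes H :: "real ^ 'n ^ 'n"
  assumes H: "pos_def H"
    and min: "\<And>t. 0 \<le> t \<Longrightarrow> t \<le> 1 \<Longrightarrow> g \<bullet> (H *v g) \<le> (g + t *\<^sub>R p) \<bullet> (H *v (g + t *\<^sub>R p))"
  shows "p \<bullet> (H *v g) \<ge> 0"
proof (rule ccontr)
  define a where "a = p \<bullet> (H *v g)"
  define c where "c = p \<bullet> (H *v p)"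
  assume "\<not> p \<bullet> (H *v g) \<ge> 0"
  then have a: "a < 0"
    by (simp add: a_def)
  then have "p \<noteq> 0"
    by (auto simp: a_def)
  then have c: "c > 0"
    using H by (simp add: c_def pos_def_def)
  \<comment> \<open>the minimizer \<open>- a / c\<close> of the quadratic \<open>2 t a + t\<^sup>2 c\<close>, cut off at the end of the segment\<close>
  define t where "t = min 1 (- a / c)"
  have t: "0 < t" "t \<le> 1" "t * c \<le> - a"
    using a c by (auto simp: t_def min_def field_simps)
  have "(g + t *\<^sub>R p) \<bullet> (H *v (g + t *\<^sub>R p)) = g \<bullet> (H *v g) + t * (2 * a + t * c)"
    using pos_def_inner_commute[OF H, of g p]
    by (simp add: a_def c_def matrix_vector_right_distrib matrix_vector_mult_scaleR
        inner_add_left inner_add_right algebra_simps)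
  with min[of t] t have "t * (2 * a + t * c) \<ge> 0"
    by simp
  moreover have "2 * a + t * c < 0"
    using t a by linarith
  ultimately show False
    using t by (simp add: zero_le_mult_iff)
qed

lemma unit_simplex_segment_axis:
  fixes l :: "real ^ 'm"
  assumes "l \<in> unit_simplex" "0 \<le> t" "t \<le> 1"
  shows "(1 - t) *\<^sub>R l + t *\<^sub>R axis i 1 \<in> unit_simplex"
  using assms
  by (auto simp: unit_simplex_def axis_def sum.distrib sum_distrib_left[symmetric])

lemma comb_grad_segment_axis:
  fixes f :: "'m::finite \<Rightarrow> real ^ 'n \<Rightarrow> real"
  shows "comb_grad f ((1 - t) *\<^sub>R l + t *\<^sub>R axis i 1) x
     = comb_grad f l x + t *\<^sub>R (grad (f i) x - comb_grad f l x)"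
proof -
  have "(\<Sum>j\<in>UNIV. (axis i 1 :: real ^ 'm) $ j *\<^sub>R grad (f j) x)
      = (\<Sum>j\<in>UNIV. if j = i then grad (f j) x else 0)"
    by (rule sum.cong) (auto simp: axis_def)
  then have "(\<Sum>j\<in>UNIV. (axis i 1 :: real ^ 'm) $ j *\<^sub>R grad (f j) x) = grad (f i) x"
    by simp
  moreover have "comb_grad f ((1 - t) *\<^sub>R l + t *\<^sub>R axis i 1) x
      = (1 - t) *\<^sub>R comb_grad f l x
        + t *\<^sub>R (\<Sum>j\<in>UNIV. (axis i 1 :: real ^ 'm) $ j *\<^sub>R grad (f j) x)"
    by (simp add: comb_grad_def scaleR_add_left sum.distrib scaleR_sum_right)
  ultimately show ?thesis
    by (simp add: algebra_simps)
qed

text \<open>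
  A direction along which every gradient has a negative inner product also has a negative inner
  product with each convex combination of the gradients.
\<close>

lemma comb_grad_nonzero_if_not_critical:
  assumes l: "l \<in> unit_simplex" and "\<not> pareto_critical f x"
  shows "comb_grad f l x \<noteq> 0"
proof
  assume zero: "comb_grad f l x = 0"
  obtain d where d: "\<And>i. grad (f i) x \<bullet> d < 0"
    using assms(2) by (auto simp: pareto_critical_def not_le)
  have l0: "l $ i \<ge> 0" and l1: "(\<Sum>i\<in>UNIV. l $ i) = 1" for i
    using l by (auto simp: unit_simplex_def)
  have "(\<Sum>i\<in>UNIV. - (l $ i * (grad (f i) x \<bullet> d))) = - (comb_grad f l x \<bullet> d)"
    by (simp add: comb_grad_def inner_sum_left sum_negf)
  also have "\<dots> = 0"
    by (simp add: zero)
  finally have "\<forall>i\<in>UNIV. - (l $ i * (grad (f i) x \<bullet> d)) = 0"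
    using d l0 by (subst (asm) sum_nonneg_eq_0_iff) (auto simp: mult_nonneg_nonpos less_imp_le)
  then have "l $ i = 0" for i
    using d[of i] by auto
  with l1 show False
    by simp
qed

text \<open>
  Moving the optimal multipliers towards a vertex of the simplex gives
  \<open>grad (f i) x \<bullet> H g \<ge> g \<bullet> H g\<close> for every \<open>i\<close>, where \<open>g\<close> is the optimal combination
  of the gradients; the right-hand side is positive since \<open>g \<noteq> 0\<close>.
\<close>

lemma max_dir_neg_if_not_critical:
  fixes f :: "'m::finite \<Rightarrow> real ^ 'n \<Rightarrow> real"
  assumes H: "pos_def H"
    and arg: "is_arg_min (\<lambda>\<mu>. 1/2 * (mat_norm H (comb_grad f \<mu> x))\<^sup>2)
                (\<lambda>\<mu>. \<mu> \<in> unit_simplex) l"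
    and "\<not> pareto_critical f x"
  shows "max_dir f x (- (H *v comb_grad f l x)) < 0"
proof -
  define g where "g = comb_grad f l x"
  have l: "l \<in> unit_simplex"
    using arg by (simp add: is_arg_min_def)
  then have "g \<noteq> 0"
    unfolding g_def using assms(3) by (rule comb_grad_nonzero_if_not_critical)
  then have gpos: "g \<bullet> (H *v g) > 0"
    using H by (simp add: pos_def_def)
  have sq: "(mat_norm H v)\<^sup>2 = v \<bullet> (H *v v)" for v
  proof -
    have "v \<bullet> (H *v v) \<ge> 0"
      using H by (cases "v = 0") (auto simp: pos_def_def less_imp_le)
    then show ?thesis
      by (simp add: mat_norm_def)
  qed
  have "grad (f i) x \<bullet> (- (H *v g)) < 0" for i
  proof -
    have "(grad (f i) x - g) \<bullet> (H *v g) \<ge> 0"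
    proof (rule minimizer_variational_inequality[OF H])
      fix t :: real assume "0 \<le> t" "t \<le> 1"
      then have "(1 - t) *\<^sub>R l + t *\<^sub>R axis i 1 \<in> unit_simplex"
        by (rule unit_simplex_segment_axis[OF l])
      then show "g \<bullet> (H *v g)
          \<le> (g + t *\<^sub>R (grad (f i) x - g)) \<bullet> (H *v (g + t *\<^sub>R (grad (f i) x - g)))"
        using arg unfolding is_arg_min_linorder sq g_def
        by (auto simp: comb_grad_segment_axis dest!: spec)
    qed
    with gpos show ?thesis
      by (simp add: inner_diff_left)
  qed
  then show ?thesis
    unfolding max_dir_def g_def[symmetric] by (subst Max_less_iff) auto
qed

section \<open>One iteration\<close>

text \<open>
  Multiplying \<open>\<eta> + max (-\<eta>) 0 = max \<eta> 0 \<ge> 0\<close> by \<open>\<parallel>s\<parallel>\<^sup>2\<close> shows that any \<open>\<delta> > 0\<close> added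
  to \<open>max (-\<eta>) 0\<close> makes the curvature positive.
\<close>

lemma shifted_curvature_pos:
  fixes y s :: "'a::real_inner"
  assumes "s \<noteq> 0" "\<delta> > 0"
  shows "(y + (max (- ((y \<bullet> s) / (norm s)\<^sup>2)) 0 + \<delta>) *\<^sub>R s) \<bullet> s > 0"
proof -
  define \<eta> where "\<eta> = (y \<bullet> s) / (norm s)\<^sup>2"
  have n: "(norm s)\<^sup>2 > 0"
    using assms by simp
  have "(y + (max (- \<eta>) 0 + \<delta>) *\<^sub>R s) \<bullet> s = y \<bullet> s + (max (- \<eta>) 0 + \<delta>) * (norm s)\<^sup>2"
    by (simp add: inner_add_left power2_norm_eq_inner)
  also have "\<dots> = (\<eta> + max (- \<eta>) 0 + \<delta>) * (norm s)\<^sup>2"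
    using n by (simp add: \<eta>_def distrib_right)
  also have "\<dots> > 0"
    using n assms(2) by (intro mult_pos_pos) auto
  finally show ?thesis
    by (simp add: \<eta>_def)
qed

lemma simplex_weighted_sum_pos:
  fixes l :: "real ^ 'm"
  assumes l: "l \<in> unit_simplex" and c: "\<And>i. c i > 0"
  shows "(\<Sum>i\<in>UNIV. l $ i * c i) > 0"
proof -
  have l0: "l $ i \<ge> 0" and l1: "(\<Sum>i\<in>UNIV. l $ i) = 1" for i
    using l by (auto simp: unit_simplex_def)
  have "\<exists>i. l $ i \<noteq> 0"
  proof (rule ccontr)
    assume "\<nexists>i. l $ i \<noteq> 0"
    with l1 show False by simp
  qed
  then obtain i where "l $ i > 0"
    using l0 by (metis less_eq_real_def)
  then show ?thesis
    using l0 c by (intro sum_pos2[where i = i]) (auto simp: less_imp_le)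
qed

lemma pos_def_mfqnmo_step:
  assumes step: "mfqnmo_step f \<sigma>1 \<sigma>2 x B x' B'"
    and B: "pos_def B" and "0 < \<sigma>1" and ncrit: "\<not> pareto_critical f x"
  shows "pos_def B'"
proof -
  obtain l d \<alpha> where
    arg: "is_arg_min (\<lambda>\<mu>. 1/2 * (mat_norm (matrix_inv B) (comb_grad f \<mu> x))\<^sup>2)
            (\<lambda>\<mu>. \<mu> \<in> unit_simplex) l"
    and d: "d = - (matrix_inv B *v comb_grad f l x)"
    and \<alpha>: "\<alpha> > 0" and wolfe: "wolfe f \<sigma>1 \<sigma>2 x d \<alpha>"
    and x': "x' = x + \<alpha> *\<^sub>R d" and B': "B' = mfqnmo_update f x x' l B"
    using step unfolding mfqnmo_step_def by blast
  have neg: "max_dir f x d < 0"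
    unfolding d by (rule max_dir_neg_if_not_critical[OF pos_def_matrix_inv[OF B] arg ncrit])
  then have "d \<noteq> 0"
    by (auto simp: max_dir_def)
  with \<alpha> have s: "x' - x \<noteq> 0"
    by (simp add: x')
  have decrease: "f i x - f i x' > 0" for i
  proof -
    have "f i x' \<le> f i x + \<sigma>1 * \<alpha> * max_dir f x d"
      using wolfe by (simp add: wolfe_def x')
    moreover have "\<sigma>1 * \<alpha> * max_dir f x d < 0"
      using \<open>0 < \<sigma>1\<close> \<alpha> neg by (simp add: mult_pos_neg)
    ultimately show ?thesis
      by linarith
  qed
  have "l \<in> unit_simplex"
    using arg by (simp add: is_arg_min_def)
  then have "(\<Sum>i\<in>UNIV. l $ i * (f i x - f i x')) > 0"
    using decrease by (rule simplex_weighted_sum_pos)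
  from pos_def_bfgs_update[OF B shifted_curvature_pos[OF s this]] show ?thesis
    unfolding B' mfqnmo_update_def Let_def .
qed

theorem theorem4p1:
  fixes f :: "'m::finite \<Rightarrow> real ^ 'n \<Rightarrow> real"
    and \<sigma>1 \<sigma>2 :: real
    and x0 :: "real ^ 'n" and B0 :: "real ^ 'n ^ 'n"
    and x :: "nat \<Rightarrow> real ^ 'n" and B :: "nat \<Rightarrow> real ^ 'n ^ 'n"
  assumes "\<And>i. cont_diff (f i)"
    and "0 < \<sigma>1" and "\<sigma>1 < \<sigma>2" and "\<sigma>2 < 1"
    and "pos_def B0"
    and "mfqnmo_sequence f \<sigma>1 \<sigma>2 x0 B0 x B"
    and "\<And>k. \<not> pareto_critical f (x k)"
  shows "\<forall>k. pos_def (B k)"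
proof
  fix k
  show "pos_def (B k)"
  proof (induction k)
    case 0
    show ?case
      using assms(5,6) by (simp add: mfqnmo_sequence_def)
  next
    case (Suc k)
    have "mfqnmo_step f \<sigma>1 \<sigma>2 (x k) (B k) (x (Suc k)) (B (Suc k))"
      using assms(6) by (simp add: mfqnmo_sequence_def)
    then show ?case
      using Suc assms(2,7) by (rule pos_def_mfqnmo_step)
  qed
qed

end
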